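(* Let $g,N\in\mathbb{N}$ with $N\ge2$ and $\gcd(g,N)=1$, and let $$P=P((1,g),N)=\left\{\left(\left\{\tfrac{k}{N}\right\},\left\{\tfrac{kg}{N}\right\}\right) : k\in\{0,1,\ldots,N-1\}\right\}\subset[0,1)^2 .$$ Let $g/N=[a_0;a_1,\ldots,a_\ell]$ be the continued fraction expansion of $g/N$ normalized so that $\ell\in\mathbb{N}$ and $a_\ell=1$, and let $K=\max(a_1,\ldots,a_\ell)$. Then $$\rho_\infty(P)\le 4(K+2).$$
   Context: $\{x\}=x-\lfloor x\rfloor$ is the fractional part. $[a_0;a_1,\ldots,a_\ell]=a_0+\cfrac{1}{a_1+\cfrac{1}{\ddots+\cfrac{1}{a_\ell}}}$ with integers $a_0\ge0$ and $a_1,\ldots,a_\ell\ge1$; every positive rational number has a unique such expansion with $\ell\ge1$ and $a_\ell=1$. For a finite set $P\subset[0,1]^2$ with $|P|\ge2$: $h_\infty(P)=\sup_{\boldsymbol{x}\in[0,1]^2}\min_{\boldsymbol{y}\in P}\|\boldsymbol{x}-\boldsymbol{y}\|_\infty$, $q_\infty(P)=\min_{\boldsymbol{x}\neq\boldsymbol{y}\in P}\|\boldsymbol{x}-\boldsymbol{y}\|_\infty/2$, and $\rho_\infty(P)=h_\infty(P)/q_\infty(P)$. *)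

theory Defs
  imports "HOL-Analysis.Analysis"
begin

text \<open>
  The plane is \<open>real \<times> real\<close> and the sup-norm on it is the library's \<^const>\<open>infnorm\<close>.  The three
  quantities below are meant for finite point sets with at least two elements; elsewhere the
  minima are unspecified.
\<close>

definition covering_radius_inf :: "(real \<times> real) set \<Rightarrow> real" where
  "covering_radius_inf P = (SUP x \<in> {0..1} \<times> {0..1}. MIN y \<in> P. infnorm (x - y))"

definition separation_radius_inf :: "(real \<times> real) set \<Rightarrow> real" where
  "separation_radius_inf P = Min {infnorm (x - y) | x y. x \<in> P \<and> y \<in> P \<and> x \<noteq> y} / 2"

definition mesh_ratio_inf :: "(real \<times> real) set \<Rightarrow> real" where
  "mesh_ratio_inf P = covering_radius_inf P / separation_radius_inf P"

text \<open>The point set \<open>P((1,g),N)\<close>.\<close>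

definition lattice_points :: "nat \<Rightarrow> nat \<Rightarrow> (real \<times> real) set" where
  "lattice_points g N =
     (\<lambda>k. (frac (real k / real N), frac (real (k * g) / real N))) ` {0..<N}"

text \<open>The value of \<open>[a 0; a 1, \<dots>, a l]\<close>; entries of \<open>a\<close> beyond index \<open>l\<close> are irrelevant.\<close>

fun cfrac_value :: "(nat \<Rightarrow> nat) \<Rightarrow> nat \<Rightarrow> real" where
  "cfrac_value a 0 = real (a 0)"
| "cfrac_value a (Suc l) = real (a 0) + 1 / cfrac_value (\<lambda>i. a (Suc i)) l"

definition normalized_cfrac :: "real \<Rightarrow> (nat \<Rightarrow> nat) \<Rightarrow> nat \<Rightarrow> bool" where
  "normalized_cfrac x a l \<longleftrightarrow>
     l \<ge> 1 \<and> (\<forall>i \<in> {1..l}. a i \<ge> 1) \<and> a l = 1 \<and> x = cfrac_value a l"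

lemma cfrac_value_ge_1: "(\<forall>i\<le>l. a i \<ge> 1) \<Longrightarrow> cfrac_value a l \<ge> 1"
proof (induction l arbitrary: a)
  case 0
  then show ?case by simp
next
  case (Suc l)
  have "cfrac_value (\<lambda>i. a (Suc i)) l \<ge> 1" using Suc by auto
  moreover have "a 0 \<ge> 1" using Suc.prems by simp
  ultimately show ?case by (simp add: add_increasing2)
qed

lemma cfrac_value_gt_1:
  assumes "\<forall>i\<le>Suc l. a i \<ge> 1"
  shows "cfrac_value a (Suc l) > 1"
proof -
  have "cfrac_value (\<lambda>i. a (Suc i)) l \<ge> 1" using assms by (intro cfrac_value_ge_1) auto
  then have "1 / cfrac_value (\<lambda>i. a (Suc i)) l > 0" by simp
  moreover have "real (a 0) \<ge> 1" using assms by simp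
  ultimately show ?thesis unfolding cfrac_value.simps by linarith
qed

lemma normalized_cfrac_exists:
  fixes p q :: nat
  assumes "p > 0" "q > 0"
  shows "\<exists>a l. normalized_cfrac (real p / real q) a l"
  using assms
proof (induction q arbitrary: p rule: less_induct)
  case (less q)
  show ?case
  proof (cases "q dvd p")
    case True
    then obtain n where n: "p = q * n" by blast
    then have "n \<ge> 1" using less.prems by (cases n) auto
    then have "normalized_cfrac (real p / real q) (\<lambda>i. if i = 0 then n - 1 else 1) (Suc 0)"
      using n less.prems by (simp add: normalized_cfrac_def of_nat_diff)
    then show ?thesis by blast
  next
    case False
    define r d where "r = p mod q" and "d = p div q"
    have r: "r > 0" "r < q" using False less.prems by (auto simp: r_def dvd_eq_mod_eq_0)
    obtain a l where al: "normalized_cfrac (real q / real r) a l"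
      using less.IH[OF r(2) less.prems(2) r(1)] by blast
    then obtain m where l: "l = Suc m" by (cases l) (auto simp: normalized_cfrac_def)
    have v: "real q / real r = cfrac_value a l" using al by (simp add: normalized_cfrac_def)
    have "a 0 \<ge> 1"
    proof (rule ccontr)
      assume "\<not> a 0 \<ge> 1"
      then have "a 0 = 0" by simp
      moreover have "cfrac_value (\<lambda>i. a (Suc i)) m \<ge> 1"
        using al l by (intro cfrac_value_ge_1) (auto simp: normalized_cfrac_def)
      ultimately have "cfrac_value a l \<le> 1" using l by simp
      moreover have "real q / real r > 1" using r by simp
      ultimately show False using v by simp
    qed
    have pos: "a i \<ge> 1" if "i \<le> l" for i
      using \<open>a 0 \<ge> 1\<close> al that by (cases "i = 0") (auto simp: normalized_cfrac_def)
    have "real p = real q * real d + real r"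
      unfolding r_def d_def by (metis mult_div_mod_eq of_nat_add of_nat_mult)
    then have "real p / real q = real d + 1 / cfrac_value a l"
      using less.prems r by (simp flip: v add: field_simps)
    then have "normalized_cfrac (real p / real q) (case_nat d a) (Suc l)"
      using pos al by (auto simp: normalized_cfrac_def split: nat.split)
    then show ?thesis by blast
  qed
qed

lemma normalized_cfrac_unique:
  assumes "normalized_cfrac x a l" "normalized_cfrac x b m"
  shows "l = m \<and> (\<forall>i\<le>l. a i = b i)"
  using assms
proof (induction l arbitrary: x a b m)
  case 0
  then show ?case by (simp add: normalized_cfrac_def)
next
  case (Suc l)
  let ?a = "\<lambda>i. a (Suc i)" and ?b = "\<lambda>i. b (Suc i)"
  obtain n where m: "m = Suc n" using Suc.prems by (cases m) (auto simp: normalized_cfrac_def)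
  have pa: "\<forall>i\<le>l. ?a i \<ge> 1" and pb: "\<forall>i\<le>n. ?b i \<ge> 1"
    using Suc.prems m by (auto simp: normalized_cfrac_def)
  define s t where "s = cfrac_value ?a l" and "t = cfrac_value ?b n"
  have st: "s \<ge> 1" "t \<ge> 1"
    using cfrac_value_ge_1[OF pa] cfrac_value_ge_1[OF pb] by (auto simp: s_def t_def)
  have eq: "real (a 0) + 1 / s = real (b 0) + 1 / t"
    using Suc.prems m by (auto simp: normalized_cfrac_def s_def t_def)
  have b: "0 < 1 / s" "1 / s \<le> 1" "0 < 1 / t" "1 / t \<le> 1" using st by auto
  have "real (a 0) < real (b 0) + 1" "real (b 0) < real (a 0) + 1" using eq b by linarith+
  then have ab: "a 0 = b 0" by linarith
  then have ts: "s = t" using eq st by simp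
  have "l = n \<and> (\<forall>i\<le>l. ?a i = ?b i)"
  proof (cases "l = 0 \<or> n = 0")
    case True
    have "l = 0 \<longleftrightarrow> s = 1"
      using cfrac_value_gt_1[of _ ?a] pa Suc.prems
      by (cases l) (fastforce simp: s_def normalized_cfrac_def simp del: cfrac_value.simps(2))+
    moreover have "n = 0 \<longleftrightarrow> t = 1"
      using cfrac_value_gt_1[of _ ?b] pb Suc.prems m
      by (cases n) (fastforce simp: t_def normalized_cfrac_def simp del: cfrac_value.simps(2))+
    ultimately have "l = 0" "n = 0" using True ts by auto
    then show ?thesis using Suc.prems m by (simp add: normalized_cfrac_def)
  next
    case False
    have "normalized_cfrac s ?a l" "normalized_cfrac s ?b n"
      using False pa pb Suc.prems m ts
      by (auto simp: normalized_cfrac_def s_def t_def)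
    then show ?thesis by (rule Suc.IH)
  qed
  then show ?case using ab m by (metis Suc_le_mono not0_implies_Suc)
qed

end

theory Submission
  imports Defs
begin

text \<open>
  Scaled by \<open>N\<close>, the points are the part in \<open>[0, N)\<^sup>2\<close> of the lattice \<open>L\<close> of all integer
  vectors \<open>(k, t)\<close> with \<open>t \<equiv> k g\<close> modulo \<open>N\<close>.  If \<open>q\<^sub>i\<close> are the denominators of the convergents
  and \<open>r\<^sub>i\<close> the remainders of Euclid's algorithm, then up to a common sign of the second
  coordinates \<open>(q\<^sub>i, r\<^sub>i)\<close> and \<open>(q\<^sub>i\<^sub>+\<^sub>1, - r\<^sub>i\<^sub>+\<^sub>1)\<close> form a basis of \<open>L\<close>.  Hence every nonzero vector of
  \<open>L\<close> has sup-norm at least \<open>min q\<^sub>i\<^sub>+\<^sub>1 r\<^sub>i\<close>, and every box of side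
  \<open>max (q\<^sub>i + q\<^sub>i\<^sub>+\<^sub>1) (r\<^sub>i + r\<^sub>i\<^sub>+\<^sub>1) \<le> 2 max q\<^sub>i\<^sub>+\<^sub>1 r\<^sub>i\<close> meets \<open>L\<close>.  Both \<open>q\<close> and \<open>r\<close> change by a factor of at
  most \<open>K + 1\<close> per step, so near the crossing of the increasing \<open>q\<^sub>i\<^sub>+\<^sub>1\<close> with the decreasing \<open>r\<^sub>i\<close>
  some \<open>i\<close> satisfies \<open>max q\<^sub>i\<^sub>+\<^sub>1 r\<^sub>i \<le> (K + 2) min q\<^sub>i\<^sub>+\<^sub>1 r\<^sub>i\<close>.
\<close>

section \<open>Lattice bases from Euclid's algorithm\<close>

text \<open>Stands for the vectors \<open>(q, r)\<close> and \<open>(q', - r')\<close> of the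
  lattice of all \<open>(k, t)\<close> with \<open>N dvd t - k * G\<close>; the determinant
  condition makes them a basis. Changing the sign of \<open>G\<close> at each step, instead of the
  signs of the remainders, keeps a single sign pattern.\<close>

definition euclid_basis :: "int \<Rightarrow> int \<Rightarrow> int \<Rightarrow> int \<Rightarrow> int \<Rightarrow> int \<Rightarrow> bool" where
  "euclid_basis G N q q' r r' \<longleftrightarrow>
     0 \<le> q \<and> q \<le> q' \<and> 1 \<le> q' \<and> 1 \<le> r' \<and> r' \<le> r \<and> q * r' + q' * r = N \<and>
     N dvd q * G - r \<and> N dvd q' * G + r'"

text \<open>The new vector is \<open>(q, r) + b * (q', - r')\<close>, so the determinant keeps its
  absolute value. Reflecting the second coordinate restores the sign pattern and turns
  \<open>G\<close> into \<open>- G\<close>.\<close>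

lemma euclid_basis_step:
  assumes "euclid_basis G N q q' r r'" "1 \<le> b" "1 \<le> r - b * r'" "r - b * r' \<le> r'"
  shows "euclid_basis (- G) N q' (b * q' + q) r' (r - b * r')"
proof -
  have D: "N dvd q * G - r" "N dvd q' * G + r'"
    using assms by (auto simp: euclid_basis_def)
  have "q' * (- G) - r' = (q' * G + r') * (-1)" by (simp add: algebra_simps)
  then have "N dvd q' * (- G) - r'" using dvd_mult2[OF D(2)] by presburger
  moreover have "(b * q' + q) * (- G) + (r - b * r') = (q' * G + r') * (- b) + (q * G - r) * (-1)"
    by (simp add: algebra_simps)
  then have "N dvd (b * q' + q) * (- G) + (r - b * r')"
    using dvd_add[OF dvd_mult2[OF D(2)] dvd_mult2[OF D(1)]] by presburger
  moreover have "1 * q' \<le> b * q'"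
    using assms by (intro mult_right_mono) (auto simp: euclid_basis_def)
  moreover have "q' * (r - b * r') + (b * q' + q) * r' = N"
    using assms by (simp add: euclid_basis_def algebra_simps)
  ultimately show ?thesis
    using assms unfolding euclid_basis_def by linarith
qed

text \<open>Induction along Euclid's algorithm with invariant \<open>q' \<le> r\<close>. If the
  current basis is not yet balanced, one step either preserves the invariant or crosses it, and a
  crossing yields a balanced basis.\<close>

lemma balanced_euclid_basis_exists:
  fixes G N q q' r r' K :: int
  assumes "euclid_basis G N q q' r r'" "coprime r r'"
    and "real_of_int r / real_of_int r' = cfrac_value a l"
    and "\<forall>i\<le>l. 1 \<le> a i \<and> int (a i) \<le> K" and "q' \<le> r"
  shows "\<exists>G' q q' r r'. (G' = G \<or> G' = - G) \<and> euclid_basis G' N q q' r r' \<and>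
           q' \<le> (K + 2) * r \<and> r \<le> (K + 2) * q'"
  using assms
proof (induction l arbitrary: a G q q' r r')
  have le: "x \<le> (K + 2) * y" if "x \<le> y" "0 \<le> y" "0 \<le> K" for x y :: int
    using that mult_right_mono[of 1 "K + 2" y] by simp
  {
    case 0
    have q': "1 \<le> q'" and r': "1 \<le> r'" using 0 by (auto simp: euclid_basis_def)
    have K: "1 \<le> K" using "0.prems"(4) by auto
    have "real_of_int r = real_of_int (int (a 0) * r')"
      using "0.prems"(3) r' by (simp add: field_simps)
    then have r: "r = int (a 0) * r'" by linarith
    \<comment> \<open>The last remainder divides its predecessor, so coprimality forces
      \<open>r' = 1\<close>, and \<open>r\<close> is the partial quotient
      \<open>a 0\<close>.\<close>
    then have "r' dvd 1" using "0.prems"(2) by (metis coprime_common_divisor dvd_refl dvd_triv_right)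
    then have "r \<le> K" using r r' "0.prems"(4) by (simp add: zdvd1_eq)
    also have "K * 1 \<le> (K + 2) * q'" using q' K by (intro mult_mono) auto
    finally have "r \<le> (K + 2) * q'" by simp
    moreover have "q' \<le> (K + 2) * r" using le[of q' r] q' K "0.prems"(5) by simp
    ultimately show ?case using "0.prems"(1) by blast
  next
    case (Suc l)
    define b where "b = int (a 0)"
    define r'' where "r'' = r - b * r'"
    define q'' where "q'' = b * q' + q"
    let ?a = "\<lambda>i. a (Suc i)"
    have q: "0 \<le> q" "q \<le> q'" "1 \<le> q'" and r': "1 \<le> r'"
      using Suc.prems(1) by (auto simp: euclid_basis_def)
    have b: "1 \<le> b" "b \<le> K" using Suc.prems(4) by (auto simp: b_def)
    have v: "cfrac_value ?a l \<ge> 1" using Suc.prems(4) by (intro cfrac_value_ge_1) auto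
    have "real_of_int r'' / real_of_int r' = 1 / cfrac_value ?a l"
      using Suc.prems(3) r' by (simp add: r''_def b_def diff_divide_distrib)
    then have rr: "real_of_int r' = real_of_int r'' * cfrac_value ?a l"
      using v r' by (simp add: field_simps)
    have "0 < real_of_int r''"
      using rr v r' by (smt (verit) of_int_pos mult_nonpos_nonneg of_int_0_le_iff)
    then have r''0: "1 \<le> r''" by simp
    have "real_of_int r'' \<le> real_of_int r'" using rr v r''0 by simp
    then have r''1: "r'' \<le> r'" by simp
    have B: "euclid_basis (- G) N q' q'' r' r''"
      unfolding q''_def r''_def
      using euclid_basis_step[OF Suc.prems(1) b(1)] r''0 r''1 by (simp add: r''_def)
    show ?case
    proof (cases "r \<le> (K + 2) * q'")
      case True
      moreover have "q' \<le> (K + 2) * r" using le[of q' r] q b Suc.prems(5) by simp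
      ultimately show ?thesis using Suc.prems(1) by blast
    next
      case False
      show ?thesis
      proof (cases "q'' \<le> r'")
        case True
        have "coprime r' r''"
          using Suc.prems(2) unfolding r''_def
          by (metis coprime_commute coprime_iff_gcd_eq_1 gcd_diff1 gcd.commute
              gcd_add_mult diff_add_cancel add.commute)
        moreover have "real_of_int r' / real_of_int r'' = cfrac_value ?a l"
          using rr r''0 by simp
        ultimately have "\<exists>G' q q' r r'. (G' = - G \<or> G' = - (- G)) \<and> euclid_basis G' N q q' r r' \<and>
           q' \<le> (K + 2) * r \<and> r \<le> (K + 2) * q'"
          using Suc.prems(4) by (intro Suc.IH[OF B _ _ _ True]) auto
        then show ?thesis by (metis minus_minus)
      next
        case False': False
        have "r = b * r' + r''" by (simp add: r''_def)
        also have "b * r' \<le> K * r'"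
          using b r' by (intro mult_right_mono) auto
        then have "b * r' + r'' \<le> (K + 1) * r'"
          using r''1 by (simp add: algebra_simps)
        finally have "r \<le> (K + 1) * r'" .
        moreover have "b * q' \<le> K * q'"
          using b q by (intro mult_right_mono) auto
        then have "q'' \<le> (K + 1) * q'"
          using q unfolding q''_def distrib_right by linarith
        \<comment> \<open>At the crossing, the failure of balance for the old basis gives
          \<open>q'' \<le> (K + 1) * q' < r \<le> (K + 1) * r'\<close>.\<close>
        ultimately have "q'' \<le> (K + 2) * r'"
          using False q r' by (simp add: algebra_simps)
        moreover have "r' \<le> (K + 2) * q''" using le[of r' q''] False' r' b by simp
        ultimately show ?thesis using B by blast
      qed
    qed
  }
qed

section \<open>Short vectors and boxes in the lattice\<close>

text \<open>Write \<open>(k, t) = x * (q, r) + y * (q', - r')\<close> with integers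
  \<open>x\<close>, \<open>y\<close>. If \<open>x = 0\<close> or both have the same sign, nothing
  cancels in \<open>k\<close>; otherwise nothing cancels in \<open>t\<close>.\<close>

lemma euclid_basis_separation:
  assumes B: "euclid_basis G N q q' r r'" and L: "N dvd t - k * G" and nz: "k \<noteq> 0 \<or> t \<noteq> 0"
  shows "q' \<le> \<bar>k\<bar> \<or> r \<le> \<bar>t\<bar>"
proof (rule ccontr)
  assume "\<not> ?thesis"
  then have small: "\<bar>k\<bar> < q'" "\<bar>t\<bar> < r" by auto
  have q: "0 \<le> q" "1 \<le> q'" "1 \<le> r'" "1 \<le> r" and N: "q * r' + q' * r = N"
    and D: "N dvd q * G - r" "N dvd q' * G + r'"
    using B by (auto simp: euclid_basis_def)
  have "0 < q' * r" "0 \<le> q * r'" using q by simp_all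
  then have "N > 0" using N by linarith
  \<comment> \<open>Cramer's rule: the numerators of both coordinates are divisible by the
    determinant, hence the coordinates are integers.\<close>
  have "N dvd (t - k * G) * q' + (q' * G + r') * k"
    by (rule dvd_add[OF dvd_mult2[OF L] dvd_mult2[OF D(2)]])
  then have "N dvd k * r' + q' * t" by (simp add: algebra_simps)
  then obtain x where x: "k * r' + q' * t = N * x" by blast
  have "N dvd (t - k * G) * (- q) + (q * G - r) * (- k)"
    by (rule dvd_add[OF dvd_mult2[OF L] dvd_mult2[OF D(1)]])
  then have "N dvd k * r - q * t" by (simp add: algebra_simps)
  then obtain y where y: "k * r - q * t = N * y" by blast
  have "N * k = N * (x * q + y * q')"
    using x y N by algebra
  then have k: "k = x * q + y * q'" using \<open>N > 0\<close> by simp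
  have "N * t = N * (x * r - y * r')"
    using x y N by algebra
  then have t: "t = x * r - y * r'" using \<open>N > 0\<close> by simp
  have big: "c \<le> z * c" if "1 \<le> z" "0 \<le> c" for z c :: int
    using that mult_right_mono[of 1 z c] by simp
  have pos: "0 \<le> z * c" if "0 \<le> z" "0 \<le> c" for z c :: int
    using that by simp
  have xy: "x \<noteq> 0 \<or> y \<noteq> 0" using nz k t by auto
  consider "x = 0" "1 \<le> y" | "x = 0" "1 \<le> - y" | "1 \<le> x" "0 \<le> - y" | "1 \<le> - x" "0 \<le> y"
    | "1 \<le> x" "1 \<le> y" | "1 \<le> - x" "1 \<le> - y"
    using xy by linarith
  then show False
  proof cases
    case 1 then show False using big[of y q'] k small q by simp
  next
    case 2 then show False using big[of "- y" q'] k small q by simp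
  next
    case 3 then show False using big[of x r] pos[of "- y" r'] t small q by linarith
  next
    case 4 then show False using big[of "- x" r] pos[of y r'] t small q by linarith
  next
    case 5 then show False using big[of y q'] pos[of x q] k small q by linarith
  next
    case 6 then show False using big[of "- y" q'] pos[of "- x" q] k small q by linarith
  qed
qed

text \<open>Rounding down both basis coordinates of an integer point moves it by a vector of the
  half-open fundamental parallelogram, whose extents are \<open>q + q'\<close> and
  \<open>r + r'\<close>.\<close>

lemma euclid_basis_covering:
  assumes B: "euclid_basis G N q q' r r'"
  shows "\<exists>k t. N dvd t - k * G \<and> c - (q + q') < k \<and> k \<le> c \<and> d - (r + r') < t \<and> t \<le> d"
proof -
  have q: "0 \<le> q" "1 \<le> q'" "1 \<le> r'" "1 \<le> r" and N: "q * r' + q' * r = N"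
    and D: "N dvd q * G - r" "N dvd q' * G + r'"
    using B by (auto simp: euclid_basis_def)
  have "0 < q' * r" "0 \<le> q * r'" using q by simp_all
  then have "N > 0" using N by linarith
  \<comment> \<open>Rounding leaves \<open>e - t\<close> strictly between \<open>- r'\<close> and
    \<open>r\<close>; this choice of \<open>e\<close> turns \<open>t < e + r'\<close> into
    \<open>t \<le> d\<close>.\<close>
  define e where "e = d - r' + 1"
  define A where "A = c * r' + q' * e"
  define C where "C = c * r - q * e"
  define x where "x = A div N"
  define y where "y = C div N"
  define k where "k = x * q + y * q'"
  define t where "t = x * r - y * r'"
  have x: "A = N * x + A mod N" by (simp add: x_def)
  have y: "C = N * y + C mod N" by (simp add: y_def)
  have m: "0 \<le> A mod N" "A mod N \<le> N - 1" "0 \<le> C mod N" "C mod N \<le> N - 1"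
    using \<open>N > 0\<close> by (simp_all add: zle_diff1_eq)
  have c: "N * (c - k) = (A mod N) * q + (C mod N) * q'"
    using x y N unfolding k_def A_def C_def by algebra
  have e: "N * (e - t) = (A mod N) * r - (C mod N) * r'"
    using x y N unfolding t_def A_def C_def by algebra
  have ub: "z * w \<le> N * w - w" "0 \<le> z * w" if "0 \<le> z" "z \<le> N - 1" "0 \<le> w" for z w :: int
    using that mult_right_mono[of z "N - 1" w] by (simp_all add: algebra_simps)
  have "0 \<le> N * (c - k)" using c m q by simp
  then have k1: "k \<le> c" using \<open>N > 0\<close> by (simp add: zero_le_mult_iff)
  have "N * (c - k) < N * (q + q')"
    unfolding c using ub(1)[of "A mod N" q] ub(1)[of "C mod N" q'] m q
    by (simp add: algebra_simps)
  then have k2: "c - (q + q') < k" using \<open>N > 0\<close> by simp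
  have "N * (e - t) < N * r"
    unfolding e using ub(1)[of "A mod N" r] ub(2)[of "C mod N" r'] m q by linarith
  then have t1: "e - r < t" using \<open>N > 0\<close> by simp
  have "N * (- r') < N * (e - t)"
    unfolding e using ub(2)[of "A mod N" r] ub(1)[of "C mod N" r'] m q by linarith
  then have t2: "t < e + r'" using \<open>N > 0\<close> by (simp only: mult_less_cancel_left_pos)
  have "N dvd (q * G - r) * (- x) + (q' * G + r') * (- y)"
    by (rule dvd_add[OF dvd_mult2[OF D(1)] dvd_mult2[OF D(2)]])
  then have "N dvd t - k * G" by (simp add: t_def k_def algebra_simps)
  then show ?thesis using k1 k2 t1 t2 unfolding e_def by (intro exI[of _ k] exI[of _ t]) auto
qed

text \<open>A balanced basis gives \<open>m = min q' r\<close> and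
  \<open>M = max (q + q') (r + r')\<close>, which is at most twice \<open>max q' r\<close>. It may
  belong to \<open>- g\<close>, whose lattice is the reflection of that of \<open>g\<close>.\<close>

lemma lattice_sup_norm_bounds:
  fixes g N :: nat
  assumes "N \<ge> 2" and "gcd g N = 1" and cf: "normalized_cfrac (real g / real N) a l"
  shows "\<exists>m M :: int. 1 \<le> m \<and> 1 \<le> M \<and> M \<le> 2 * (int (Max (a ` {1..l})) + 2) * m \<and>
    (\<forall>k t. int N dvd t - k * int g \<longrightarrow> k \<noteq> 0 \<or> t \<noteq> 0 \<longrightarrow> m \<le> max \<bar>k\<bar> \<bar>t\<bar>) \<and>
    (\<forall>c d. \<exists>k t. int N dvd t - k * int g \<and> c - M < k \<and> k \<le> c \<and> d - M < t \<and> t \<le> d)"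
proof -
  define K where "K = int (Max (a ` {1..l}))"
  obtain n where l: "l = Suc n" using cf by (cases l) (auto simp: normalized_cfrac_def)
  let ?a = "\<lambda>i. a (Suc i)"
  have a: "\<forall>i\<le>n. 1 \<le> ?a i \<and> int (?a i) \<le> K"
    using cf l by (auto simp: normalized_cfrac_def K_def intro!: Max_ge)
  then have K: "1 \<le> K" by force
  define s where "s = int g - int (a 0) * int N"
  have v: "cfrac_value ?a n \<ge> 1" using a by (intro cfrac_value_ge_1) auto
  have "real g / real N = real (a 0) + 1 / cfrac_value ?a n"
    using cf l by (simp add: normalized_cfrac_def)
  then have s: "real_of_int s * cfrac_value ?a n = real N"
    using v assms(1) by (simp add: s_def field_simps)
  have s0: "1 \<le> s"
  proof -
    have "0 < real_of_int s * cfrac_value ?a n" using s assms(1) by simp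
    then have "0 < real_of_int s" using v by (simp add: zero_less_mult_iff)
    then show ?thesis by simp
  qed
  have "real_of_int s \<le> real N" unfolding s[symmetric] using s0 v by simp
  then have s1: "s \<le> int N" by linarith
  have "coprime (int N) (int g)"
    using assms(2) by (simp add: coprime_iff_gcd_eq_1 gcd.commute)
  then have cop: "coprime (int N) s"
    unfolding s_def
    by (metis coprime_iff_gcd_eq_1 gcd_add_mult diff_add_cancel add.commute)
  \<comment> \<open>Euclid's algorithm starts after \<open>a 0\<close> is split off: the basis is
    \<open>(0, N)\<close>, \<open>(1, - s)\<close>, and \<open>N / s\<close> has the remaining
    partial quotients.\<close>
  have "euclid_basis (- int g) (int N) 0 1 (int N) s"
    using s0 s1 by (auto simp: euclid_basis_def s_def)
  then have "\<exists>G' q q' r r'. (G' = - int g \<or> G' = - (- int g)) \<and> euclid_basis G' (int N) q q' r r' \<and>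
           q' \<le> (K + 2) * r \<and> r \<le> (K + 2) * q'"
    using cop a s s0 assms(1)
    by (intro balanced_euclid_basis_exists[where a = ?a and l = n and q = 0 and q' = 1
          and r = "int N" and r' = s]) (auto simp: field_simps)
  then obtain G q q' r r' where G: "G = int g \<or> G = - int g"
    and B: "euclid_basis G (int N) q q' r r'" and bal: "q' \<le> (K + 2) * r" "r \<le> (K + 2) * q'"
    unfolding minus_minus by blast
  define m where "m = min q' r"
  define M where "M = max (q + q') (r + r')"
  have q: "0 \<le> q" "q \<le> q'" "1 \<le> q'" "1 \<le> r'" "r' \<le> r" using B by (auto simp: euclid_basis_def)
  have le: "x \<le> (K + 2) * x" if "1 \<le> x" for x :: int
    using that K mult_right_mono[of 1 "K + 2" x] by simp
  have "q' \<le> (K + 2) * m" "r \<le> (K + 2) * m"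
    using bal le[of q'] le[of r] q by (auto simp: m_def min_def)
  then have Mm: "M \<le> 2 * (K + 2) * m" unfolding M_def using q by linarith
  have sep: "m \<le> max \<bar>k\<bar> \<bar>t\<bar>" if "int N dvd t - k * int g" "k \<noteq> 0 \<or> t \<noteq> 0" for k t
  proof -
    have "int N dvd t - k * G \<or> int N dvd - t - k * G"
      using that(1) G by (auto simp: dvd_diff_commute)
    then show ?thesis
      using euclid_basis_separation[OF B, of t k] euclid_basis_separation[OF B, of "- t" k] that(2)
      by (auto simp: m_def)
  qed
  have cov: "\<exists>k t. int N dvd t - k * int g \<and> c - M < k \<and> k \<le> c \<and> d - M < t \<and> t \<le> d" for c d
    using G
  proof
    assume "G = int g"
    then show ?thesis
      using euclid_basis_covering[OF B, of c d] unfolding M_def by fastforce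
  next
    assume G: "G = - int g"
    \<comment> \<open>Reflection sends the integers in \<open>(d - M, d]\<close> to those from
      \<open>- d\<close> to \<open>M - 1 - d\<close>.\<close>
    obtain k t where kt: "int N dvd t - k * G" "c - (q + q') < k" "k \<le> c"
        "(M - 1 - d) - (r + r') < t" "t \<le> M - 1 - d"
      using euclid_basis_covering[OF B, of c "M - 1 - d"] by blast
    have "int N dvd - t - k * int g"
      using kt(1) G by (metis dvd_minus_iff minus_diff_eq minus_mult_right diff_minus_eq_add
          add.commute uminus_add_conv_diff)
    moreover have "d - M < - t" using kt(5) by linarith
    moreover have "- t \<le> d" using kt(4) by (simp add: M_def)
    moreover have "c - M < k" using kt(2) by (simp add: M_def)
    ultimately show ?thesis using kt(3) by blast
  qed
  have "1 \<le> m" "1 \<le> M" using q by (auto simp: m_def M_def)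
  then show ?thesis using Mm sep cov unfolding K_def by blast
qed

section \<open>From the lattice to the point set in the unit square\<close>

lemma infnorm_prod_real: "infnorm (x :: real \<times> real) = max \<bar>fst x\<bar> \<bar>snd x\<bar>"
proof -
  have "(\<lambda>b. \<bar>x \<bullet> b\<bar>) ` Basis = {\<bar>fst x\<bar>, \<bar>snd x\<bar>}"
    by (auto simp: Basis_prod_def inner_prod_def)
  then show ?thesis by (simp add: infnorm_Max)
qed

lemma frac_nat_divide:
  fixes n N :: nat
  assumes "N > 0"
  shows "frac (real n / real N) = real (n mod N) / real N"
proof -
  have "real n = real N * real (n div N) + real (n mod N)"
    by (metis mult_div_mod_eq of_nat_add of_nat_mult)
  then have "real n / real N - real (n mod N) / real N = of_int (int (n div N))"
    using assms by (simp add: field_simps)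
  then show ?thesis
    unfolding frac_unique_iff using assms by simp
qed

lemma lattice_points_eq:
  assumes "N > 0"
  shows "lattice_points g N = (\<lambda>k. (real k / real N, real (k * g mod N) / real N)) ` {0..<N}"
  unfolding lattice_points_def using assms
  by (intro image_cong) (auto simp: frac_nat_divide simp del: of_nat_mult)

lemma lattice_points_memI:
  fixes k t :: int
  assumes "0 \<le> k" "k < int N" "0 \<le> t" "t < int N" "int N dvd t - k * int g"
  shows "(real_of_int k / real N, real_of_int t / real N) \<in> lattice_points g N"
proof -
  have "t mod int N = k * int g mod int N" using assms(5) by (simp add: mod_eq_dvd_iff)
  then have "t = int (nat k * g mod N)" using assms by (simp add: zmod_int)
  then have "real_of_int t = real (nat k * g mod N)" by linarith
  moreover have "nat k \<in> {0..<N}" using assms by auto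
  ultimately show ?thesis
    using assms by (subst lattice_points_eq) (auto intro!: image_eqI[of _ _ "nat k"])
qed

text \<open>Scaled by \<open>N\<close>, the difference of two distinct points is a nonzero lattice
  vector; the 2 comes from the halving in the separation radius.\<close>

lemma separation_radius_lattice_points_ge:
  fixes m :: int
  assumes "N \<ge> 2"
    and sep: "\<And>k t. int N dvd t - k * int g \<Longrightarrow> k \<noteq> 0 \<or> t \<noteq> 0 \<Longrightarrow> m \<le> max \<bar>k\<bar> \<bar>t\<bar>"
  shows "real_of_int m / (2 * real N) \<le> separation_radius_inf (lattice_points g N)"
proof -
  define P where "P = lattice_points g N"
  let ?D = "{infnorm (x - y) | x y. x \<in> P \<and> y \<in> P \<and> x \<noteq> y}"
  have P: "P = (\<lambda>k. (real k / real N, real (k * g mod N) / real N)) ` {0..<N}"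
    using assms(1) by (simp add: P_def lattice_points_eq)
  have "?D \<subseteq> (\<lambda>(x, y). infnorm (x - y)) ` (P \<times> P)" by (auto simp del: diff_Pair)
  moreover have "finite P" by (simp add: P)
  ultimately have fin: "finite ?D" using finite_subset by blast
  let ?f = "\<lambda>k. (real k / real N, real (k * g mod N) / real N)"
  \<comment> \<open>Two distinct points exist because \<open>N \<ge> 2\<close>, so the minimum is
    over a nonempty set.\<close>
  have "?f 0 \<in> P" "?f 1 \<in> P" "?f 0 \<noteq> ?f 1" using assms(1) unfolding P by auto
  then have ne: "?D \<noteq> {}" by blast
  have "real_of_int m / real N \<le> d" if "d \<in> ?D" for d
  proof -
    from that obtain x y where xy: "x \<in> P" "y \<in> P" "x \<noteq> y" "d = infnorm (x - y)" by blast
    moreover from xy(1,2) obtain i j where "i < N" "j < N" "x = ?f i" "y = ?f j"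
      unfolding P by (elim imageE) auto
    ultimately have ij: "i < N" "j < N" "?f i \<noteq> ?f j" "d = infnorm (?f i - ?f j)" by simp_all
    define k where "k = int i - int j"
    define t where "t = int (i * g mod N) - int (j * g mod N)"
    have "t mod int N = (int (i * g) - int (j * g)) mod int N"
      unfolding t_def by (simp add: zmod_int mod_diff_eq del: of_nat_mult)
    then have "int N dvd t - k * int g"
      by (simp add: mod_eq_dvd_iff k_def algebra_simps)
    moreover have "k \<noteq> 0" using ij by (auto simp: k_def)
    ultimately have "m \<le> max \<bar>k\<bar> \<bar>t\<bar>" using sep by blast
    then have "real_of_int m \<le> real_of_int (max \<bar>k\<bar> \<bar>t\<bar>)" by (simp only: of_int_le_iff)
    then have "real_of_int m / real N \<le> max \<bar>real_of_int k\<bar> \<bar>real_of_int t\<bar> / real N"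
      using assms(1) by (intro divide_right_mono) auto
    also have "\<dots> = d"
      using assms(1)
      by (simp add: ij(4) infnorm_prod_real k_def t_def max_divide_distrib_right
          flip: diff_divide_distrib)
    finally show ?thesis .
  qed
  then have "real_of_int m / real N \<le> Min ?D" using fin ne by (simp add: Min_ge_iff del: mem_Collect_eq)
  then show ?thesis by (simp add: separation_radius_inf_def P_def)
qed

text \<open>
  The box around a point near the boundary of \<open>[0, N]\<^sup>2\<close> is shifted inside: the point set is not
  periodic.
\<close>
lemma clamped_interval:
  fixes M :: int and N :: nat and X :: real
  assumes "1 \<le> M" "M \<le> int N" "0 \<le> X" "X \<le> real N"
  obtains c where "\<And>k :: int. c - M < k \<Longrightarrow> k \<le> c \<Longrightarrow>
    0 \<le> k \<and> k < int N \<and> \<bar>X - real_of_int k\<bar> \<le> real_of_int M"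
proof -
  define f where "f = \<lfloor>X\<rfloor>"
  \<comment> \<open>The lower clamp \<open>M - 1\<close> keeps all \<open>k > ?c - M\<close>
    nonnegative, the upper one keeps \<open>k\<close> below \<open>N\<close>.\<close>
  let ?c = "max (M - 1) (min (int N - 1) f)"
  have f: "real_of_int f \<le> X" "X < real_of_int f + 1" by (simp_all add: f_def)
  show thesis
  proof (rule that[of ?c])
    fix k :: int
    assume k: "?c - M < k" "k \<le> ?c"
    have "0 \<le> k \<and> k < int N" using k assms by linarith
    moreover have "real_of_int k \<le> real_of_int ?c" "real_of_int ?c - real_of_int M + 1 \<le> real_of_int k"
      using k by linarith+
    ultimately show "0 \<le> k \<and> k < int N \<and> \<bar>X - real_of_int k\<bar> \<le> real_of_int M"
      using f assms by (simp add: of_int_max of_int_min)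
  qed
qed

lemma covering_radius_lattice_points_le:
  fixes M :: int
  assumes "N \<ge> 2" "1 \<le> M"
    and cov: "\<And>c d. \<exists>k t. int N dvd t - k * int g \<and> c - M < k \<and> k \<le> c \<and> d - M < t \<and> t \<le> d"
  shows "covering_radius_inf (lattice_points g N) \<le> real_of_int M / real N"
proof -
  define P where "P = lattice_points g N"
  have fin: "finite P" by (simp add: P_def lattice_points_def)
  have N: "real N > 0" using assms(1) by simp
  have near: "\<exists>y \<in> P. infnorm ((u, v) - y) \<le> real_of_int M / real N"
    if uv: "0 \<le> u" "u \<le> 1" "0 \<le> v" "v \<le> 1" for u v :: real
  proof (cases "M \<le> int N")
    case True
    have *: "0 \<le> real N * z" "real N * z \<le> real N" if "0 \<le> z" "z \<le> 1" for z
      using that mult_left_mono[of z 1 "real N"] by simp_all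
    obtain c where c: "\<And>k :: int. c - M < k \<Longrightarrow> k \<le> c \<Longrightarrow>
        0 \<le> k \<and> k < int N \<and> \<bar>real N * u - real_of_int k\<bar> \<le> real_of_int M"
      using clamped_interval[OF assms(2) True *[OF uv(1,2)]] by metis
    obtain d where d: "\<And>k :: int. d - M < k \<Longrightarrow> k \<le> d \<Longrightarrow>
        0 \<le> k \<and> k < int N \<and> \<bar>real N * v - real_of_int k\<bar> \<le> real_of_int M"
      using clamped_interval[OF assms(2) True *[OF uv(3,4)]] by metis
    obtain k t where kt: "int N dvd t - k * int g" "c - M < k" "k \<le> c" "d - M < t" "t \<le> d"
      using cov by blast
    have scale: "\<bar>z - real_of_int i / real N\<bar> \<le> real_of_int M / real N"
      if "\<bar>real N * z - real_of_int i\<bar> \<le> real_of_int M" for z i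
    proof -
      have "z - real_of_int i / real N = (real N * z - real_of_int i) / real N"
        using N by (simp add: field_simps)
      then show ?thesis using that N by (simp add: abs_divide divide_right_mono)
    qed
    show ?thesis
    proof
      show "(real_of_int k / real N, real_of_int t / real N) \<in> P"
        unfolding P_def using c d kt by (intro lattice_points_memI) auto
      show "infnorm ((u, v) - (real_of_int k / real N, real_of_int t / real N))
          \<le> real_of_int M / real N"
        using scale c[OF kt(2,3)] d[OF kt(4,5)] by (simp add: infnorm_prod_real)
    qed
  next
    case False
    \<comment> \<open>When \<open>M > N\<close> no shifted box fits, but the bound exceeds 1 and the
      origin is close enough to every point of the square.\<close>
    have "(real_of_int 0 / real N, real_of_int 0 / real N) \<in> P"
      unfolding P_def using assms(1) by (intro lattice_points_memI) auto
    moreover have "1 \<le> real_of_int M / real N" using False N by simp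
    ultimately show ?thesis
      using uv by (intro bexI[of _ "(0, 0)"]) (auto simp: infnorm_prod_real)
  qed
  show ?thesis
    unfolding covering_radius_inf_def P_def[symmetric]
  proof (rule cSUP_least)
    fix x :: "real \<times> real"
    assume "x \<in> {0..1} \<times> {0..1}"
    then obtain y where y: "y \<in> P" "infnorm (x - y) \<le> real_of_int M / real N"
      using near[of "fst x" "snd x"] by (auto simp: mem_Times_iff)
    have "(MIN y \<in> P. infnorm (x - y)) \<le> infnorm (x - y)"
      using y(1) fin by (intro Min_le) auto
    then show "(MIN y \<in> P. infnorm (x - y)) \<le> real_of_int M / real N" using y(2) by linarith
  qed simp
qed

theorem corollary3p3:
  fixes g N l :: nat and a :: "nat \<Rightarrow> nat"
  assumes "N \<ge> 2" and "gcd g N = 1"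
    and "normalized_cfrac (real g / real N) a l"
  shows "mesh_ratio_inf (lattice_points g N) \<le> 4 * (real (Max (a ` {1..l})) + 2)"
proof -
  define K where "K = Max (a ` {1..l})"
  let ?h = "covering_radius_inf (lattice_points g N)"
  let ?q = "separation_radius_inf (lattice_points g N)"
  obtain m M :: int where m: "1 \<le> m" and M: "1 \<le> M" and Mm: "M \<le> 2 * (int K + 2) * m"
    and sep: "\<And>k t. int N dvd t - k * int g \<Longrightarrow> k \<noteq> 0 \<or> t \<noteq> 0 \<Longrightarrow> m \<le> max \<bar>k\<bar> \<bar>t\<bar>"
    and cov: "\<And>c d. \<exists>k t. int N dvd t - k * int g \<and> c - M < k \<and> k \<le> c \<and> d - M < t \<and> t \<le> d"
    using lattice_sup_norm_bounds[OF assms] unfolding K_def by metis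
  have N: "real N > 0" using assms(1) by simp
  have q: "real_of_int m / (2 * real N) \<le> ?q"
    by (rule separation_radius_lattice_points_ge[OF assms(1) sep])
  have "0 < real_of_int m / (2 * real N)" using m N by simp
  then have "0 < ?q" using q by linarith
  have "real_of_int M \<le> real_of_int (2 * (int K + 2) * m)" using Mm by (simp only: of_int_le_iff)
  then have "real_of_int M / real N \<le> 2 * (real K + 2) * real_of_int m / real N"
    using N by (simp add: divide_right_mono)
  \<comment> \<open>The factor 4 combines the 2 in the bound on \<open>M\<close> with the halving in
    the separation radius.\<close>
  also have "\<dots> = 4 * (real K + 2) * (real_of_int m / (2 * real N))"
    using N by (simp add: field_simps)
  also have "\<dots> \<le> 4 * (real K + 2) * ?q" using q by (intro mult_left_mono) auto
  finally have "?h \<le> 4 * (real K + 2) * ?q"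
    using covering_radius_lattice_points_le[OF assms(1) M cov] by linarith
  then show ?thesis
    using \<open>0 < ?q\<close> by (simp add: mesh_ratio_inf_def pos_divide_le_eq K_def)
qed

end
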